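(* There exist a nonempty compact polar set $K\subset\mathbb{C}$ and a subharmonic function $u$ on $\mathbb{C}$, harmonic on $\mathbb{C}\setminus K$, such that $u(z)=-\infty$ for every $z\in K$ and $$\lim_{z\to K}\frac{u(z)}{\ln \operatorname{dist}(z,K)}=0.$$
   Context: Here $\operatorname{dist}(z,K)=\min_{w\in K}|z-w|$, and $\lim_{z\to K}$ means the limit as $\operatorname{dist}(z,K)\to 0$ with $z\in\mathbb{C}\setminus K$. A set is polar if it has logarithmic capacity zero, equivalently if it is contained in the $-\infty$ set of a subharmonic function on $\mathbb{C}$ that is not identically $-\infty$. *)

theory Defs
  imports "HOL-Probability.Probability" "HOL-Library.Going_To_Filter"
begin

section \<open>Integrals of extended-real functions\<close>

text \<open>
  Positive part minus negative part; in ereal the difference \<open>\<infinity> - \<infinity>\<close> is \<open>\<infinity>\<close>, but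
  below the integrands are bounded above and the measures finite, so that the
  first integral is finite and the value lies in \<open>[-\<infinity>, \<infinity>)\<close>.
\<close>

definition ereal_integral :: "'a measure \<Rightarrow> ('a \<Rightarrow> ereal) \<Rightarrow> ereal" where
  "ereal_integral M f =
     enn2ereal (\<integral>\<^sup>+ x. e2ennreal (f x) \<partial>M) - enn2ereal (\<integral>\<^sup>+ x. e2ennreal (- f x) \<partial>M)"

lemma ereal_integral_eq_integral:
  fixes f :: "'a \<Rightarrow> real"
  assumes "integrable M f"
  shows "ereal_integral M (\<lambda>x. ereal (f x)) = ereal (integral\<^sup>L M f)"
proof -
  have "(\<integral>\<^sup>+ x. ennreal (f x) \<partial>M) \<noteq> \<infinity>" "(\<integral>\<^sup>+ x. ennreal (- f x) \<partial>M) \<noteq> \<infinity>"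
    using assms by (auto simp: real_integrable_def)
  then show ?thesis
    unfolding ereal_integral_def real_lebesgue_integral_def[OF assms]
    by (cases rule: ennreal2_cases[of "\<integral>\<^sup>+ x. ennreal (f x) \<partial>M" "\<integral>\<^sup>+ x. ennreal (- f x) \<partial>M"])
      (auto simp: enn2ereal_ennreal)
qed

section \<open>Harmonic and subharmonic functions\<close>

text \<open>
  Twice continuously differentiable (in the real sense) with vanishing Laplacian;
  \<open>hx\<close>, \<open>hy\<close>, \<open>hxx\<close>, \<open>hxy\<close>, \<open>hyx\<close>, \<open>hyy\<close> are the partial derivatives with respect to
  \<open>x = Re z\<close> and \<open>y = Im z\<close>.
\<close>

definition harmonic_on :: "(complex \<Rightarrow> real) \<Rightarrow> complex set \<Rightarrow> bool" where
  "harmonic_on h U \<longleftrightarrow> open U \<and>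
     (\<exists>hx hy hxx hxy hyx hyy :: complex \<Rightarrow> real.
        (\<forall>z\<in>U.
           (h has_derivative (\<lambda>v. hx z * Re v + hy z * Im v)) (at z) \<and>
           (hx has_derivative (\<lambda>v. hxx z * Re v + hxy z * Im v)) (at z) \<and>
           (hy has_derivative (\<lambda>v. hyx z * Re v + hyy z * Im v)) (at z)) \<and>
        continuous_on U hxx \<and> continuous_on U hxy \<and>
        continuous_on U hyx \<and> continuous_on U hyy \<and>
        (\<forall>z\<in>U. hxx z + hyy z = 0))"

definition circle_mean :: "(complex \<Rightarrow> ereal) \<Rightarrow> complex \<Rightarrow> real \<Rightarrow> ereal" where
  "circle_mean u w r =
     ereal (1 / (2 * pi)) *
       ereal_integral (restrict_space lborel {0..2 * pi}) (\<lambda>t. u (w + of_real r * cis t))"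

text \<open>
  Upper semicontinuous functions \<open>U \<rightarrow> [-\<infinity>, \<infinity>)\<close> satisfying the local submean
  inequality. The constant \<open>-\<infinity>\<close> is admitted.
\<close>

definition subharmonic_on :: "(complex \<Rightarrow> ereal) \<Rightarrow> complex set \<Rightarrow> bool" where
  "subharmonic_on u U \<longleftrightarrow> open U \<and>
     (\<forall>z\<in>U. u z < \<infinity>) \<and>
     (\<forall>c. open {z\<in>U. u z < c}) \<and>
     (\<forall>w\<in>U. \<exists>\<rho>>0. ball w \<rho> \<subseteq> U \<and> (\<forall>r. 0 \<le> r \<and> r < \<rho> \<longrightarrow> u w \<le> circle_mean u w r))"

section \<open>Logarithmic capacity\<close>

definition log_dist :: "complex \<Rightarrow> complex \<Rightarrow> ereal" where
  "log_dist z w = (if z = w then -\<infinity> else ereal (ln (dist z w)))"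

definition log_energy :: "complex measure \<Rightarrow> ereal" where
  "log_energy \<mu> = ereal_integral (\<mu> \<Otimes>\<^sub>M \<mu>) (\<lambda>(z, w). log_dist z w)"

definition compact_prob_measures :: "complex set \<Rightarrow> complex measure set" where
  "compact_prob_measures E =
     {\<mu>. prob_space \<mu> \<and> sets \<mu> = sets borel \<and>
         (\<exists>C. compact C \<and> C \<subseteq> E \<and> emeasure \<mu> (- C) = 0)}"

text \<open>
  The supremum of \<open>exp (I(\<mu>))\<close> over all such measures, where \<open>I(\<mu>)\<close> is the energy
  \<open>\<integral>\<integral> ln |z - w| d\<mu>(z) d\<mu>(w) \<in> [-\<infinity>, \<infinity>)\<close> and \<open>exp (-\<infinity>) = 0\<close>. The supremum is taken
  in ennreal, so the empty set has capacity 0.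
\<close>

definition log_capacity :: "complex set \<Rightarrow> ennreal" where
  "log_capacity E =
     (SUP \<mu> \<in> compact_prob_measures E.
        if log_energy \<mu> = -\<infinity> then 0 else ennreal (exp (real_of_ereal (log_energy \<mu>))))"

definition polar :: "complex set \<Rightarrow> bool" where
  "polar E \<longleftrightarrow> log_capacity E = 0"

end

theory Submission
  imports Defs "HOL-Complex_Analysis.Complex_Analysis"
begin

text \<open>
  A logarithmic potential \<open>z \<mapsto> \<integral> ln \<bar>z - w\<bar> d\<mu>(w)\<close> of a probability measure on a compact set \<open>K\<close>
  is harmonic off \<open>K\<close>. Two competing demands have to be met by \<open>\<mu>\<close>. The potential must tend to
  \<open>-\<infinity>\<close> at every point of \<open>K\<close>, so \<open>\<mu>\<close> has to be strongly concentrated; and it must be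
  \<open>o(ln dist(z, K))\<close>. The second demand only asks that small discs have uniformly small measure:
  if discs of radius \<open>r\<close> about points of \<open>K\<close> have measure at most \<open>\<epsilon>\<close> and \<open>z\<close> is close to \<open>K\<close>,
  then the part of \<open>\<mu>\<close> within \<open>r\<close> of the point of \<open>K\<close> nearest to \<open>z\<close> contributes at least
  \<open>\<epsilon> ln dist(z, K)\<close> and the rest at least \<open>ln (r/2)\<close>, a constant (\<open>potential_sublogarithmic\<close>).

  Both are satisfied by a Cantor set with extremely fast decreasing scales: at level \<open>n\<close> it is
  covered by \<open>2\<^sup>n\<close> pieces of diameter at most \<open>exp (-8\<^sup>n)\<close>, each of measure \<open>2\<^sup>-\<^sup>n\<close>. A point within
  \<open>exp (-8\<^sup>n)\<close> of the set lies within \<open>2 exp (-8\<^sup>n)\<close> of every point of some piece, so its potential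
  is at most about \<open>-8\<^sup>n / 2\<^sup>n = -4\<^sup>n\<close> (\<open>potential_near_cantor_set\<close>). One level suffices here because the
  exponents grow faster than the number of pieces.

  The same covering gives polarity. By the pigeonhole principle a
  probability measure on \<open>K\<close> charges some piece with at least \<open>2\<^sup>-\<^sup>n\<close>, hence its product with itself
  charges the square of that piece with at least \<open>4\<^sup>-\<^sup>n\<close>; on that square the logarithmic kernel is at
  most \<open>-8\<^sup>n\<close>, so the energy is at most \<open>-2\<^sup>n\<close> for every \<open>n\<close> (\<open>polar_of_thin_covers\<close>).

  The set and its measure come from a single increasing jump function on \<open>[0, 1)\<close>, the staircase:
  the measure is the image of Lebesgue measure, the set is the closure of the range, and the pieces
  are the closures of the images of the dyadic intervals.

  The potential, extended by \<open>-\<infinity>\<close> on \<open>K\<close>, is upper semicontinuous because it tends to \<open>-\<infinity>\<close> at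
  \<open>K\<close>. The local submean inequality is trivial at points of \<open>K\<close>, and at other points it is the mean
  value property on discs that avoid \<open>K\<close> (\<open>subharmonic_on_extend_by_MInfty\<close>).
\<close>

section \<open>Harmonic functions through their holomorphic gradient\<close>

text \<open>
  For harmonic \<open>h\<close> the function \<open>G = h\<^sub>x - \<i> h\<^sub>y\<close> is holomorphic; conversely the Cauchy-Riemann
  equations of \<open>G\<close> say that the mixed second derivatives of \<open>h\<close> agree and that its Laplacian
  vanishes. Speaking of \<open>G\<close> avoids naming a holomorphic function with real part \<open>h\<close>, which exists
  only locally.
\<close>

lemma harmonic_on_of_holomorphic_gradient:
  assumes U: "open U" and G: "G holomorphic_on U"
    and h: "\<And>z. z \<in> U \<Longrightarrow> (h has_derivative (\<lambda>v. Re (G z * v))) (at z)"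
  shows "harmonic_on h U"
proof -
  define G' where "G' = deriv G"
  have cont: "continuous_on U G'"
    unfolding G'_def by (intro holomorphic_on_imp_continuous_on holomorphic_deriv G U)
  have dG: "(G has_derivative (\<lambda>v. G' z * v)) (at z)" if "z \<in> U" for z
    using holomorphic_derivI[OF G U that] unfolding G'_def has_field_derivative_def by simp
  have re: "((\<lambda>z. Re (G z)) has_derivative (\<lambda>v. Re (G' z) * Re v + (- Im (G' z)) * Im v)) (at z)"
    if "z \<in> U" for z
    using bounded_linear.has_derivative[OF bounded_linear_Re dG[OF that]] by (simp add: algebra_simps)
  have im: "((\<lambda>z. - Im (G z)) has_derivative (\<lambda>v. (- Im (G' z)) * Re v + (- Re (G' z)) * Im v)) (at z)"
    if "z \<in> U" for z
    using has_derivative_minus[OF bounded_linear.has_derivative[OF bounded_linear_Im dG[OF that]]]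
    by (simp add: algebra_simps)
  have grad: "(h has_derivative (\<lambda>v. Re (G z) * Re v + (- Im (G z)) * Im v)) (at z)" if "z \<in> U" for z
    using h[OF that] by simp
  show ?thesis
    unfolding harmonic_on_def
    by (rule conjI[OF U], rule exI[of _ "\<lambda>z. Re (G z)"], rule exI[of _ "\<lambda>z. - Im (G z)"],
        rule exI[of _ "\<lambda>z. Re (G' z)"], rule exI[of _ "\<lambda>z. - Im (G' z)"],
        rule exI[of _ "\<lambda>z. - Im (G' z)"], rule exI[of _ "\<lambda>z. - Re (G' z)"],
        intro conjI ballI grad re im continuous_intros cont) simp_all
qed

lemma holomorphic_mean_value:
  assumes f: "f holomorphic_on ball w \<rho>" and r: "0 \<le> r" "r < \<rho>"
  shows "((\<lambda>t. f (w + of_real r * cis t)) has_integral of_real (2 * pi) * f w) {0..2 * pi}"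
proof (cases "r = 0")
  case True
  then show ?thesis
    using has_integral_const_real[of "f w" 0 "2 * pi"] by (simp add: scaleR_conv_of_real)
next
  case False
  have "f holomorphic_on cball w r"
    by (rule holomorphic_on_subset[OF f]) (use r in auto)
  then have "((\<lambda>u. f u / (u - w)) has_contour_integral 2 * of_real pi * \<i> * f w) (circlepath w r)"
    by (rule Cauchy_integral_circlepath_simple) (use False r in auto)
  then have "((\<lambda>t. f (w + r * cis t) / (r * cis t) * r * \<i> * cis t)
      has_integral 2 * of_real pi * \<i> * f w) {0..2 * pi}"
    unfolding circlepath_def by (subst (asm) has_contour_integral_part_circlepath_iff) auto
  then have "((\<lambda>t. \<i> * f (w + r * cis t)) has_integral \<i> * (of_real (2 * pi) * f w)) {0..2 * pi}"
    using False by (simp add: field_simps)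
  from has_integral_mult_right[OF this, of "- \<i>"] show ?thesis
    by simp
qed

text \<open>
  On a disc the gradient function \<open>G\<close> has a primitive, whose real part differs from \<open>h\<close> by a
  constant. This reduces the claim to the mean value property of holomorphic functions.
\<close>

lemma circle_mean_eq_of_holomorphic_gradient:
  fixes u :: "complex \<Rightarrow> ereal" and h :: "complex \<Rightarrow> real"
  assumes G: "G holomorphic_on ball w \<rho>"
    and h: "\<And>z. z \<in> ball w \<rho> \<Longrightarrow> (h has_derivative (\<lambda>v. Re (G z * v))) (at z)"
    and u: "\<And>z. z \<in> ball w \<rho> \<Longrightarrow> u z = ereal (h z)"
    and r: "0 \<le> r" "r < \<rho>"
  shows "circle_mean u w r = u w"
proof -
  obtain F where "\<And>z. z \<in> ball w \<rho> \<Longrightarrow> (F has_field_derivative G z) (at z within ball w \<rho>)"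
    using holomorphic_convex_primitive'[OF convex_ball open_ball G] by metis
  then have F: "(F has_field_derivative G z) (at z)" if "z \<in> ball w \<rho>" for z
    using that by (metis at_within_open open_ball)
  have "((\<lambda>z. h z - Re (F z)) has_derivative (\<lambda>v. 0)) (at z within ball w \<rho>)"
    if z: "z \<in> ball w \<rho>" for z
  proof -
    have "(F has_derivative (\<lambda>v. G z * v)) (at z)"
      using F[OF z] by (simp add: has_field_derivative_def)
    from has_derivative_diff[OF h[OF z] bounded_linear.has_derivative[OF bounded_linear_Re this]]
    show ?thesis by (auto intro: has_derivative_at_withinI)
  qed
  then have "\<exists>c. \<forall>z\<in>ball w \<rho>. h z - Re (F z) = c"
    by (rule has_derivative_zero_constant[OF convex_ball])
  then obtain c where c: "\<And>z. z \<in> ball w \<rho> \<Longrightarrow> h z - Re (F z) = c"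
    by blast
  have circle: "w + of_real r * cis t \<in> ball w \<rho>" for t
    using r by (simp add: dist_norm norm_mult)
  have "F holomorphic_on ball w \<rho>"
    using F holomorphic_on_open[OF open_ball] by blast
  from has_integral_add[OF has_integral_Re[OF holomorphic_mean_value[OF this r]]
      has_integral_const_real[of c 0 "2 * pi"]]
  have "((\<lambda>t. Re (F (w + of_real r * cis t)) + c) has_integral 2 * pi * Re (F w) + 2 * pi * c) {0..2 * pi}"
    by simp
  moreover have "Re (F (w + of_real r * cis t)) + c = h (w + of_real r * cis t)" for t
    using c[OF circle] by (simp add: algebra_simps)
  moreover have "2 * pi * Re (F w) + 2 * pi * c = 2 * pi * h w"
    using c[of w] r by (simp add: algebra_simps)
  ultimately have int: "((\<lambda>t. h (w + of_real r * cis t)) has_integral 2 * pi * h w) {0..2 * pi}"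
    by simp
  have "continuous_on (ball w \<rho>) h"
    using h by (meson continuous_at_imp_continuous_on has_derivative_continuous)
  then have "continuous_on {0..2 * pi} (\<lambda>t. h (w + of_real r * cis t))"
    by (rule continuous_on_compose2) (use circle in \<open>auto intro!: continuous_intros\<close>)
  then have si: "set_integrable lborel {0..2 * pi} (\<lambda>t. h (w + of_real r * cis t))"
    unfolding set_integrable_def by (intro borel_integrable_compact) auto
  then have "integrable (restrict_space lborel {0..2 * pi}) (\<lambda>t. h (w + of_real r * cis t))"
    by (simp add: integrable_restrict_space set_integrable_def)
  moreover have "(\<integral>t. h (w + of_real r * cis t) \<partial>restrict_space lborel {0..2 * pi}) = 2 * pi * h w"
    using set_borel_integral_eq_integral(2)[OF si] integral_unique[OF int]
    by (simp add: integral_restrict_space set_lebesgue_integral_def)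
  ultimately have "ereal_integral (restrict_space lborel {0..2 * pi})
      (\<lambda>t. ereal (h (w + of_real r * cis t))) = ereal (2 * pi * h w)"
    by (simp add: ereal_integral_eq_integral)
  then have "circle_mean u w r = ereal (1 / (2 * pi)) * ereal (2 * pi * h w)"
    unfolding circle_mean_def u[OF circle] by simp
  also have "\<dots> = u w"
    using u[of w] r by simp
  finally show ?thesis .
qed

text \<open>
  Uniform decay near \<open>K\<close> makes the extension upper semicontinuous. The radius in the submean
  inequality may depend on the centre, so circles that meet \<open>K\<close> need to be considered only for
  centres in \<open>K\<close>, where the left-hand side is \<open>-\<infinity>\<close>.
\<close>

lemma subharmonic_on_extend_by_MInfty:
  assumes K: "compact K" and G: "G holomorphic_on - K"
    and h: "\<And>z. z \<in> - K \<Longrightarrow> (h has_derivative (\<lambda>v. Re (G z * v))) (at z)"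
    and low: "\<And>c. \<exists>\<delta>>0. \<forall>z\<in>- K. infdist z K < \<delta> \<longrightarrow> h z < c"
  shows "subharmonic_on (\<lambda>z. if z \<in> K then -\<infinity> else ereal (h z)) UNIV"
proof (cases "K = {}")
  case False
  define u where "u = (\<lambda>z. if z \<in> K then -\<infinity> else ereal (h z))"
  have Kc: "open (- K)"
    using K by (simp add: compact_imp_closed open_Compl)
  have usc: "open {z. u z < c}" for c
  proof (cases c)
    case (real c')
    obtain \<delta> where \<delta>: "\<delta> > 0" "\<And>z. z \<in> - K \<Longrightarrow> infdist z K < \<delta> \<Longrightarrow> h z < c'"
      using low by blast
    have "{z. u z < c} = {z. infdist z K < \<delta>} \<union> {z \<in> - K. h z < c'}"
      using \<delta> real by (auto simp: u_def split: if_splits)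
    moreover have "open {z. infdist z K < \<delta>}"
      by (intro open_Collect_less continuous_intros)
    moreover have "open {z \<in> - K. h z < c'}"
    proof -
      have "continuous_on (- K) h"
        using h by (meson continuous_at_imp_continuous_on has_derivative_continuous)
      then have "open (- K \<inter> h -` {..<c'})"
        by (intro continuous_open_preimage Kc) auto
      then show ?thesis
        by (simp add: Int_def vimage_def)
    qed
    ultimately show ?thesis
      by auto
  next
    case PInf
    then have "{z. u z < c} = UNIV"
      by (auto simp: u_def)
    then show ?thesis
      by simp
  next
    case MInf
    then show ?thesis
      by simp
  qed
  have mean: "\<exists>\<rho>>0. ball w \<rho> \<subseteq> UNIV \<and> (\<forall>r. 0 \<le> r \<and> r < \<rho> \<longrightarrow> u w \<le> circle_mean u w r)" for w
  proof (cases "w \<in> K")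
    case True
    then show ?thesis
      by (auto simp: u_def intro: exI[of _ 1])
  next
    case w: False
    then obtain \<rho> where \<rho>: "\<rho> > 0" "ball w \<rho> \<subseteq> - K"
      using Kc open_contains_ball by (metis ComplI)
    have "circle_mean u w r = u w" if "0 \<le> r" "r < \<rho>" for r
      by (rule circle_mean_eq_of_holomorphic_gradient[where G = G and h = h and \<rho> = \<rho>])
        (use that \<rho> h in \<open>auto simp: u_def intro: holomorphic_on_subset[OF G]\<close>)
    then show ?thesis
      using \<rho> by (intro exI[of _ \<rho>]) auto
  qed
  have "u z < \<infinity>" for z
    by (simp add: u_def)
  then have "subharmonic_on u UNIV"
    unfolding subharmonic_on_def using usc mean by simp
  then show ?thesis
    by (simp add: u_def)
next
  case True
  with low[of "h 0"] show ?thesis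
    by (auto simp: infdist_def)
qed

section \<open>Logarithmic potentials\<close>

text \<open>
  A quadratic bound on the remainder survives integration over a probability space. This is how
  differentiation under the integral sign is justified for the potential and for its gradient.
\<close>

lemma has_derivative_of_quadratic_remainder:
  fixes F :: "'b::real_normed_vector \<Rightarrow> 'c::real_normed_vector"
  assumes e: "e > 0" and D: "bounded_linear D"
    and rem: "\<And>v. norm v < e \<Longrightarrow> norm (F (z + v) - F z - D v) \<le> C * (norm v)\<^sup>2"
  shows "(F has_derivative D) (at z)"
proof (rule has_derivativeI_sandwich[OF e D])
  fix y assume y: "y \<noteq> z" "dist y z < e"
  then have "norm (F y - F z - D (y - z)) \<le> C * (norm (y - z))\<^sup>2"
    using rem[of "y - z"] by (simp add: dist_norm)
  then show "norm (F y - F z - D (y - z)) / norm (y - z) \<le> C * norm (y - z)"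
    using y by (simp add: divide_simps power2_eq_square)
next
  have "((\<lambda>y. C * norm (y - z)) \<longlongrightarrow> C * norm (z - z)) (at z)"
    by (intro tendsto_intros)
  then show "((\<lambda>y. C * norm (y - z)) \<longlongrightarrow> 0) (at z)"
    by simp
qed

text \<open>
  The quadratic remainder in the first-order expansion of \<open>ln \<bar>\<cdot>\<bar>\<close> at \<open>a\<close>, with a constant that
  depends only on a lower bound for \<open>\<bar>a\<bar>\<close>; it comes from \<open>Ln (1 + \<zeta>) = \<zeta> + O(\<zeta>\<^sup>2)\<close> for \<open>\<zeta> = v / a\<close>.
\<close>

lemma ln_norm_remainder:
  fixes a v :: complex
  assumes d: "0 < d" "d \<le> norm a" and v: "norm v \<le> d / 2"
  shows "\<bar>ln (norm (a + v)) - ln (norm a) - Re (v / a)\<bar> \<le> 2 / d\<^sup>2 * (norm v)\<^sup>2"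
proof -
  define \<zeta> where "\<zeta> = v / a"
  have a: "a \<noteq> 0"
    using d by auto
  have \<zeta>d: "norm \<zeta> \<le> norm v / d"
    unfolding \<zeta>_def norm_divide using d a by (intro divide_left_mono mult_pos_pos) auto
  also have "\<dots> \<le> 1 / 2"
    using d v by (simp add: divide_simps)
  finally have \<zeta>: "norm \<zeta> \<le> 1 / 2" .
  then have nz: "1 + \<zeta> \<noteq> 0"
    by (metis add.inverse_unique divide_less_eq_1_pos norm_minus_cancel norm_one not_less one_less_numeral_iff semiring_norm(76) zero_less_numeral)
  have "a + v = a * (1 + \<zeta>)"
    using a by (simp add: \<zeta>_def field_simps)
  then have "ln (norm (a + v)) = ln (norm a) + ln (norm (1 + \<zeta>))"
    using a nz by (simp add: norm_mult ln_mult)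
  then have "\<bar>ln (norm (a + v)) - ln (norm a) - Re (v / a)\<bar> = \<bar>Re (Ln (1 + \<zeta>) - \<zeta>)\<bar>"
    using nz by (simp add: \<zeta>_def)
  also have "\<dots> \<le> norm (Ln (1 + \<zeta>) - \<zeta>)"
    by (rule abs_Re_le_cmod)
  also have "\<dots> \<le> (norm \<zeta>)\<^sup>2 / (1 - norm \<zeta>)"
    by (rule Ln_approx_linear) (use \<zeta> in auto)
  also have "\<dots> \<le> (norm \<zeta>)\<^sup>2 / (1 / 2)"
    using \<zeta> by (intro divide_left_mono) auto
  also have "\<dots> \<le> (norm v / d)\<^sup>2 / (1 / 2)"
    using \<zeta>d by (intro divide_right_mono power_mono) auto
  finally show ?thesis
    by (simp add: power_divide mult.commute)
qed

lemma inverse_remainder: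
  fixes a v :: complex
  assumes d: "0 < d" "d \<le> norm a" and v: "norm v \<le> d / 2"
  shows "norm (1 / (a + v) - 1 / a - v * (- 1 / a\<^sup>2)) \<le> 2 / d ^ 3 * (norm v)\<^sup>2"
proof -
  have av: "d / 2 \<le> norm (a + v)"
    using norm_diff_ineq[of a v] d v by linarith
  have nz: "a \<noteq> 0" "a + v \<noteq> 0"
    using d av by auto
  then have "1 / (a + v) - 1 / a - v * (- 1 / a\<^sup>2) = v\<^sup>2 / (a\<^sup>2 * (a + v))"
    by (simp add: divide_simps) (simp add: algebra_simps power2_eq_square)
  then have "norm (1 / (a + v) - 1 / a - v * (- 1 / a\<^sup>2)) = (norm v)\<^sup>2 / ((norm a)\<^sup>2 * norm (a + v))"
    by (simp add: norm_divide norm_mult norm_power)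
  also have "\<dots> \<le> (norm v)\<^sup>2 / (d\<^sup>2 * (d / 2))"
    using d av nz by (intro divide_left_mono mult_mono power_mono mult_pos_pos) auto
  also have "\<dots> = 2 / d ^ 3 * (norm v)\<^sup>2"
    by (simp add: power2_eq_square power3_eq_cube)
  finally show ?thesis .
qed

text \<open>
  The measure \<open>\<mu>\<close> is represented as the distribution of a random variable \<open>X\<close>, so that its
  potential is an expectation over the (simpler) underlying space. The set \<open>K\<close> may be larger than
  the support of the distribution.
\<close>

locale compactly_valued = prob_space M for M :: "'a measure" +
  fixes X :: "'a \<Rightarrow> complex" and K :: "complex set"
  assumes X_measurable [measurable]: "X \<in> borel_measurable M"
    and compact_K: "compact K"
    and X_in_K: "\<And>t. t \<in> space M \<Longrightarrow> X t \<in> K"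
begin

definition potential :: "complex \<Rightarrow> real" where
  "potential z = (\<integral>t. ln (norm (z - X t)) \<partial>M)"

definition cauchy_transform :: "complex \<Rightarrow> complex" where
  "cauchy_transform z = (\<integral>t. 1 / (z - X t) \<partial>M)"

lemma K_nonempty: "K \<noteq> {}"
  using not_empty X_in_K by blast

lemma infdist_pos: "z \<notin> K \<Longrightarrow> 0 < infdist z K"
  using compact_imp_closed[OF compact_K] K_nonempty by (intro infdist_pos_not_in_closed)

lemma infdist_le_norm: "t \<in> space M \<Longrightarrow> infdist z K \<le> norm (z - X t)"
  using infdist_le[OF X_in_K] by (simp add: dist_norm)

lemma integrable_ln_norm:
  assumes z: "z \<notin> K"
  shows "integrable M (\<lambda>t. ln (norm (z - X t)))"
proof -
  obtain B where B: "\<And>w. w \<in> K \<Longrightarrow> norm (z - w) \<le> B"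
    using compact_imp_bounded[OF compact_K] unfolding bounded_any_center[where a = z] dist_norm by blast
  let ?C = "max \<bar>ln (infdist z K)\<bar> \<bar>ln B\<bar>"
  have "norm (ln (norm (z - X t))) \<le> ?C" if t: "t \<in> space M" for t
  proof -
    have "0 < norm (z - X t)"
      using infdist_pos[OF z] infdist_le_norm[OF t, of z] by linarith
    then have "ln (infdist z K) \<le> ln (norm (z - X t))" "ln (norm (z - X t)) \<le> ln B"
      using infdist_pos[OF z] infdist_le_norm[OF t, of z] B[OF X_in_K[OF t]]
      by (auto intro!: ln_mono simp del: zero_less_norm_iff)
    then show ?thesis
      by auto
  qed
  then show ?thesis
    by (intro integrable_const_bound[where B = ?C]) auto
qed

lemma integrable_inverse_power:
  assumes z: "z \<notin> K"
  shows "integrable M (\<lambda>t. 1 / (z - X t) ^ n)"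
proof (rule integrable_const_bound[where B = "1 / infdist z K ^ n"])
  have "norm (1 / (z - X t) ^ n) \<le> 1 / infdist z K ^ n" if t: "t \<in> space M" for t
    unfolding norm_divide norm_power norm_one
    using infdist_pos[OF z] infdist_le_norm[OF t, of z]
    by (intro divide_left_mono power_mono mult_pos_pos zero_less_power) auto
  then show "AE t in M. norm (1 / (z - X t) ^ n) \<le> 1 / infdist z K ^ n"
    by auto
qed measurable

lemma norm_expectation_le:
  fixes f :: "'a \<Rightarrow> 'c::{banach, second_countable_topology}"
  assumes "integrable M f" "\<And>t. t \<in> space M \<Longrightarrow> norm (f t) \<le> C"
  shows "norm (\<integral>t. f t \<partial>M) \<le> C"
proof -
  have "norm (\<integral>t. f t \<partial>M) \<le> (\<integral>t. norm (f t) \<partial>M)"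
    by (rule integral_norm_bound)
  also have "\<dots> \<le> (\<integral>t. C \<partial>M)"
    using assms by (intro integral_mono) auto
  finally show ?thesis
    by (simp add: prob_space)
qed

lemma shift_notin_K:
  assumes "z \<notin> K" "norm v < infdist z K / 2"
  shows "z + v \<notin> K"
proof
  assume "z + v \<in> K"
  then have "infdist z K \<le> norm v"
    using infdist_le[of "z + v" K z] by (simp add: dist_norm)
  then show False
    using assms infdist_pos[of z] by linarith
qed

lemma has_derivative_potential:
  assumes z: "z \<notin> K"
  shows "(potential has_derivative (\<lambda>v. Re (cauchy_transform z * v))) (at z)"
proof (rule has_derivative_of_quadratic_remainder)
  let ?d = "infdist z K"
  show "0 < ?d / 2"
    using infdist_pos[OF z] by simp
  show "bounded_linear (\<lambda>v. Re (cauchy_transform z * v))"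
    by (intro bounded_linear_compose[OF bounded_linear_Re] bounded_linear_mult_right)
  fix v :: complex assume v: "norm v < ?d / 2"
  have inv: "integrable M (\<lambda>t. 1 / (z - X t))"
    using integrable_inverse_power[OF z, of 1] by simp
  have int: "integrable M (\<lambda>t. Re (v / (z - X t)))"
    using integrable_Re[OF integrable_mult_right[OF inv, of v]] by simp
  have "(\<integral>t. Re (v / (z - X t)) \<partial>M) = Re (cauchy_transform z * v)"
    using integral_Re[OF integrable_mult_right[OF inv, of v]]
      integral_mult_right_zero[of M v "\<lambda>t. 1 / (z - X t)"]
    by (simp add: cauchy_transform_def mult.commute[of _ v] del: times_complex.sel)
  then have "potential (z + v) - potential z - Re (cauchy_transform z * v)
      = (\<integral>t. ln (norm (z + v - X t)) - ln (norm (z - X t)) - Re (v / (z - X t)) \<partial>M)"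
    unfolding potential_def
    using integrable_ln_norm[OF z] integrable_ln_norm[OF shift_notin_K[OF z v]] int by simp
  also have "norm \<dots> \<le> 2 / ?d\<^sup>2 * (norm v)\<^sup>2"
  proof (rule norm_expectation_le)
    show "integrable M (\<lambda>t. ln (norm (z + v - X t)) - ln (norm (z - X t)) - Re (v / (z - X t)))"
      using integrable_ln_norm[OF z] integrable_ln_norm[OF shift_notin_K[OF z v]] int by simp
    fix t assume "t \<in> space M"
    then show "norm (ln (norm (z + v - X t)) - ln (norm (z - X t)) - Re (v / (z - X t)))
        \<le> 2 / ?d\<^sup>2 * (norm v)\<^sup>2"
      using ln_norm_remainder[OF infdist_pos[OF z] infdist_le_norm, of t v] v
      by (simp add: algebra_simps)
  qed
  finally show "norm (potential (z + v) - potential z - Re (cauchy_transform z * v))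
      \<le> 2 / ?d\<^sup>2 * (norm v)\<^sup>2" .
qed

lemma holomorphic_cauchy_transform: "cauchy_transform holomorphic_on - K"
proof -
  have "cauchy_transform field_differentiable at z" if "z \<in> - K" for z
  proof -
    from that have z: "z \<notin> K" by simp
    let ?d = "infdist z K"
    let ?c = "\<integral>t. - 1 / (z - X t)\<^sup>2 \<partial>M"
    have inv: "integrable M (\<lambda>t. 1 / (y - X t))" if "y \<notin> K" for y
      using integrable_inverse_power[OF that, of 1] by simp
    have sq: "integrable M (\<lambda>t. - 1 / (z - X t)\<^sup>2)"
      using integrable_minus[OF integrable_inverse_power[OF z, of 2]] by simp
    have "(cauchy_transform has_derivative (\<lambda>v. ?c * v)) (at z)"
    proof (rule has_derivative_of_quadratic_remainder)
      show "0 < ?d / 2"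
        using infdist_pos[OF z] by simp
      show "bounded_linear (\<lambda>v. ?c * v)"
        by (rule bounded_linear_mult_right)
      fix v :: complex assume v: "norm v < ?d / 2"
      have "?c * v = (\<integral>t. v * (- 1 / (z - X t)\<^sup>2) \<partial>M)"
        using integral_mult_right_zero[of M v "\<lambda>t. - 1 / (z - X t)\<^sup>2"] by (simp only: mult.commute)
      then have "cauchy_transform (z + v) - cauchy_transform z - ?c * v
          = (\<integral>t. 1 / (z + v - X t) - 1 / (z - X t) - v * (- 1 / (z - X t)\<^sup>2) \<partial>M)"
        unfolding cauchy_transform_def
        using inv[OF z] inv[OF shift_notin_K[OF z v]] integrable_mult_right[OF sq, of v]
        by (simp only: Bochner_Integration.integral_diff Bochner_Integration.integrable_diff)
      also have "norm \<dots> \<le> 2 / ?d ^ 3 * (norm v)\<^sup>2"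
      proof (rule norm_expectation_le)
        show "integrable M (\<lambda>t. 1 / (z + v - X t) - 1 / (z - X t) - v * (- 1 / (z - X t)\<^sup>2))"
          using inv[OF z] inv[OF shift_notin_K[OF z v]] integrable_mult_right[OF sq, of v]
          by (intro Bochner_Integration.integrable_diff)
        fix t assume "t \<in> space M"
        then show "norm (1 / (z + v - X t) - 1 / (z - X t) - v * (- 1 / (z - X t)\<^sup>2))
            \<le> 2 / ?d ^ 3 * (norm v)\<^sup>2"
          using inverse_remainder[OF infdist_pos[OF z] infdist_le_norm, of t v] v
          by (simp add: diff_add_eq)
      qed
      finally show "norm (cauchy_transform (z + v) - cauchy_transform z - ?c * v)
          \<le> 2 / ?d ^ 3 * (norm v)\<^sup>2" .
    qed
    then show ?thesis
      unfolding field_differentiable_def has_field_derivative_def by blast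
  qed
  then show ?thesis
    by (simp add: holomorphic_on_def field_differentiable_at_within)
qed

text \<open>
  All distances are at most 1, so the logarithm is nowhere positive and everything outside \<open>A\<close> may
  be discarded.
\<close>

lemma potential_le:
  assumes z: "z \<notin> K" and A: "A \<in> sets M" and d: "d \<le> 1"
    and near: "\<And>t. t \<in> A \<Longrightarrow> norm (z - X t) \<le> d"
    and all: "\<And>t. t \<in> space M \<Longrightarrow> norm (z - X t) \<le> 1"
  shows "potential z \<le> prob A * ln d"
proof -
  have "potential z \<le> (\<integral>t. indicator A t * ln d \<partial>M)"
    unfolding potential_def
  proof (rule integral_mono)
    show "integrable M (\<lambda>t. ln (norm (z - X t)))"
      by (rule integrable_ln_norm[OF z])
    show "integrable M (\<lambda>t. indicator A t * ln d)"
      using A by (intro integrable_mult_left integrable_real_indicator) (auto simp: emeasure_eq_measure)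
    fix t assume t: "t \<in> space M"
    have "0 < norm (z - X t)"
      using infdist_pos[OF z] infdist_le_norm[OF t, of z] by linarith
    then show "ln (norm (z - X t)) \<le> indicator A t * ln d"
      using near[of t] all[OF t] by (auto simp: indicator_def intro!: ln_mono simp del: zero_less_norm_iff)
  qed
  also have "\<dots> = prob A * ln d"
    using A by (simp add: sets.Int_space_eq2)
  finally show ?thesis .
qed

text \<open>
  The two bounds \<open>dist(z, K)\<close>, valid everywhere, and \<open>r\<close>, valid outside \<open>A\<close>, have non-positive
  logarithms; the worse of them is therefore bounded below by their sum.
\<close>

lemma potential_ge:
  assumes z: "z \<notin> K" and A: "A \<in> sets M" and r: "0 < r" "r \<le> 1"
    and near: "infdist z K \<le> 1"
    and far: "\<And>t. t \<in> space M - A \<Longrightarrow> r \<le> norm (z - X t)"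
  shows "prob A * ln (infdist z K) + ln r \<le> potential z"
proof -
  have int: "integrable M (\<lambda>t. indicator A t * ln (infdist z K))"
    using A by (intro integrable_mult_left integrable_real_indicator) (auto simp: emeasure_eq_measure)
  have "prob A * ln (infdist z K) + ln r = (\<integral>t. indicator A t * ln (infdist z K) + ln r \<partial>M)"
    using A int by (simp add: sets.Int_space_eq2 prob_space)
  also have "\<dots> \<le> potential z"
    unfolding potential_def
  proof (rule integral_mono)
    show "integrable M (\<lambda>t. indicator A t * ln (infdist z K) + ln r)"
      using int by simp
    show "integrable M (\<lambda>t. ln (norm (z - X t)))"
      by (rule integrable_ln_norm[OF z])
    fix t assume t: "t \<in> space M"
    have "ln r \<le> 0"
      using r by simp
    moreover have "ln (infdist z K) \<le> ln (norm (z - X t))"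
      using infdist_pos[OF z] infdist_le_norm[OF t, of z] by (intro ln_mono) auto
    moreover have "ln r \<le> ln (norm (z - X t))" if "t \<notin> A"
      using far[of t] that t r by (intro ln_mono) auto
    ultimately show "indicator A t * ln (infdist z K) + ln r \<le> ln (norm (z - X t))"
      by (cases "t \<in> A") auto
  qed
  finally show ?thesis .
qed

text \<open>
  The hypothesis \<open>small\<close> is uniform absence of atoms. Without it the claim fails: an atom of mass
  \<open>m\<close> at an isolated point of \<open>K\<close> makes the quotient tend to \<open>m\<close> there.
\<close>

lemma potential_sublogarithmic:
  assumes small: "\<And>\<epsilon>. \<epsilon> > 0 \<Longrightarrow> \<exists>r>0. \<forall>x\<in>K. prob {t \<in> space M. dist (X t) x < r} \<le> \<epsilon>"
    and neg: "\<forall>\<^sub>F z in (\<lambda>z. infdist z K) going_to nhds 0 within - K. potential z \<le> 0"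
  shows "((\<lambda>z. potential z / ln (infdist z K)) \<longlongrightarrow> 0)
           ((\<lambda>z. infdist z K) going_to nhds 0 within - K)"
    (is "(_ \<longlongrightarrow> 0) ?F")
proof (rule tendstoI)
  fix \<epsilon> :: real assume \<epsilon>: "\<epsilon> > 0"
  then obtain r0 where r0: "r0 > 0"
      "\<And>x. x \<in> K \<Longrightarrow> prob {t \<in> space M. dist (X t) x < r0} \<le> \<epsilon> / 2"
    using small[of "\<epsilon> / 2"] by auto
  define r where "r = min r0 1"
  have r: "0 < r" "r \<le> 1"
    using r0 by (auto simp: r_def)
  \<comment> \<open>Below the second bound the constant \<open>ln (r / 2)\<close> costs less than \<open>\<epsilon> / 3\<close> times
      \<open>ln (infdist z K)\<close>, so that together with the \<open>\<epsilon> / 2\<close> from the near part less than \<open>\<epsilon>\<close> is used.\<close>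
  define \<delta> where "\<delta> = min (r / 2) (exp (3 * ln (r / 2) / \<epsilon>))"
  have "\<delta> > 0"
    using r by (simp add: \<delta>_def)
  then have "\<forall>\<^sub>F z in ?F. infdist z K < \<delta> \<and> z \<in> - K"
    by (auto simp: eventually_going_to_nhds intro: exI[of _ "{..<\<delta>}"])
  then show "\<forall>\<^sub>F z in ?F. dist (potential z / ln (infdist z K)) 0 < \<epsilon>"
    using neg
  proof eventually_elim
    case (elim z)
    let ?d = "infdist z K"
    have d: "0 < ?d" "?d < r / 2" "?d < exp (3 * ln (r / 2) / \<epsilon>)"
      using elim infdist_pos[of z] by (auto simp: \<delta>_def)
    obtain x where x: "x \<in> K" "?d = dist z x"
      using infdist_attains_inf[OF compact_imp_closed[OF compact_K] K_nonempty] by metis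
    define A where "A = {t \<in> space M. dist (X t) x < r}"
    have "ln ?d < 3 * ln (r / 2) / \<epsilon>"
      using ln_less_cancel_iff[of ?d "exp (3 * ln (r / 2) / \<epsilon>)"] d by simp
    then have ln_d: "\<epsilon> * ln ?d < 3 * ln (r / 2)"
      using \<epsilon> by (simp add: field_simps)
    have neg_ln: "ln ?d < 0" "ln (r / 2) < 0"
      using d r by auto
    have "A \<subseteq> {t \<in> space M. dist (X t) x < r0}"
      by (auto simp: A_def r_def)
    then have "prob A \<le> prob {t \<in> space M. dist (X t) x < r0}"
      by (intro finite_measure_mono) measurable
    then have "prob A \<le> \<epsilon> / 2"
      using r0(2)[OF x(1)] by linarith
    then have "\<epsilon> / 2 * ln ?d \<le> prob A * ln ?d"
      using neg_ln by (simp add: mult_right_mono_neg)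
    moreover have "prob A * ln ?d + ln (r / 2) \<le> potential z"
    proof (rule potential_ge)
      show "z \<notin> K" "A \<in> sets M" "0 < r / 2" "r / 2 \<le> 1" "?d \<le> 1"
        using elim r d by (auto simp: A_def)
      fix t assume "t \<in> space M - A"
      then have "r \<le> dist (X t) x"
        by (auto simp: A_def not_less)
      also have "\<dots> \<le> norm (z - X t) + dist z x"
        using dist_triangle[of "X t" x z] by (simp add: dist_norm norm_minus_commute)
      \<comment> \<open>\<open>dist z x\<close> is the distance of \<open>z\<close> from \<open>K\<close>, which is below \<open>r / 2\<close>.\<close>
      finally show "r / 2 \<le> norm (z - X t)"
        using x d by linarith
    qed
    ultimately have "\<epsilon> * ln ?d < potential z"
      using ln_d neg_ln by linarith
    then show ?case
      using elim neg_ln \<epsilon> by (simp add: abs_if divide_simps)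
  qed
qed

end

section \<open>Polarity from thin coverings\<close>

text \<open>
  A set \<open>E\<close> with \<open>\<nu> E \<ge> m\<close> and diameter at most \<open>exp (- B / m\<^sup>2)\<close> contributes at most
  \<open>- B / m\<^sup>2 \<cdot> \<nu>(E)\<^sup>2 \<le> - B\<close> to the energy. As distances in \<open>C\<close> do not exceed 1, no positive
  contribution can compensate for this.
\<close>

lemma log_energy_eq_MInfty:
  assumes \<nu>: "prob_space \<nu>" "sets \<nu> = sets borel"
    and C: "compact C" "emeasure \<nu> (- C) = 0"
    and diam: "\<And>x y. x \<in> C \<Longrightarrow> y \<in> C \<Longrightarrow> dist x y \<le> 1"
    and heavy: "\<And>B::real. B \<ge> 0 \<Longrightarrow> \<exists>E m. closed E \<and> 0 < m \<and> m \<le> measure \<nu> E \<and>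
      (\<forall>x\<in>E. \<forall>y\<in>E. dist x y \<le> exp (- B / m\<^sup>2))"
  shows "log_energy \<nu> = -\<infinity>"
proof -
  interpret \<nu>: prob_space \<nu> by (rule \<nu>(1))
  let ?L = "\<lambda>(z, w). log_dist z w"
  have closed_sets: "E \<in> sets \<nu>" if "closed E" for E
    using that \<nu>(2) by simp
  have C_sets: "- C \<in> sets \<nu>"
    using C(1) \<nu>(2) by (simp add: compact_imp_closed borel_open open_Compl)
  have UNIV_sets: "UNIV \<in> sets \<nu>"
    using \<nu>(2) by simp
  have "(\<integral>\<^sup>+ p. e2ennreal (?L p) \<partial>(\<nu> \<Otimes>\<^sub>M \<nu>)) = (\<integral>\<^sup>+ p. 0 \<partial>(\<nu> \<Otimes>\<^sub>M \<nu>))"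
  proof (rule nn_integral_cong_AE, rule AE_I')
    show "(- C) \<times> UNIV \<union> UNIV \<times> (- C) \<in> null_sets (\<nu> \<Otimes>\<^sub>M \<nu>)"
      by (intro null_sets.Un null_setsI)
        (use C_sets UNIV_sets C(2) in \<open>auto simp: \<nu>.emeasure_pair_measure_Times\<close>)
    have "e2ennreal (log_dist z w) = 0" if "z \<in> C" "w \<in> C" for z w
      using diam[OF that] by (auto simp: log_dist_def e2ennreal_neg)
    then show "{p \<in> space (\<nu> \<Otimes>\<^sub>M \<nu>). e2ennreal (?L p) \<noteq> 0} \<subseteq> (- C) \<times> UNIV \<union> UNIV \<times> (- C)"
      by auto
  qed
  then have pos: "(\<integral>\<^sup>+ p. e2ennreal (?L p) \<partial>(\<nu> \<Otimes>\<^sub>M \<nu>)) = 0"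
    by simp
  have large: "ennreal B \<le> (\<integral>\<^sup>+ p. e2ennreal (- ?L p) \<partial>(\<nu> \<Otimes>\<^sub>M \<nu>))" if B: "B \<ge> 0" for B
  proof -
    obtain E m where E: "closed E" "0 < m" "m \<le> measure \<nu> E"
        "\<And>x y. x \<in> E \<Longrightarrow> y \<in> E \<Longrightarrow> dist x y \<le> exp (- B / m\<^sup>2)"
      using heavy[OF B] by blast
    have "ennreal B = ennreal (B / m\<^sup>2 * (m * m))"
      using E(2) by (simp add: power2_eq_square)
    also have "\<dots> \<le> ennreal (B / m\<^sup>2 * (measure \<nu> E * measure \<nu> E))"
      using E B by (intro ennreal_leI mult_left_mono mult_mono) auto
    also have "\<dots> = ennreal (B / m\<^sup>2) * emeasure (\<nu> \<Otimes>\<^sub>M \<nu>) (E \<times> E)"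
      using B closed_sets[OF E(1)]
      by (simp add: \<nu>.emeasure_pair_measure_Times \<nu>.emeasure_eq_measure flip: ennreal_mult)
    also have "\<dots> = (\<integral>\<^sup>+ p. ennreal (B / m\<^sup>2) * indicator (E \<times> E) p \<partial>(\<nu> \<Otimes>\<^sub>M \<nu>))"
      using closed_sets[OF E(1)] by (simp add: nn_integral_cmult_indicator)
    also have "\<dots> \<le> (\<integral>\<^sup>+ p. e2ennreal (- ?L p) \<partial>(\<nu> \<Otimes>\<^sub>M \<nu>))"
    proof (rule nn_integral_mono)
      fix p :: "complex \<times> complex"
      obtain z w where p: "p = (z, w)"
        by (cases p)
      have "ennreal (B / m\<^sup>2) \<le> e2ennreal (- log_dist z w)" if "z \<in> E" "w \<in> E"
      proof (cases "z = w")
        case False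
        then have "ln (dist z w) \<le> ln (exp (- B / m\<^sup>2))"
          using E(4)[OF that] by (intro ln_mono) auto
        then have "ennreal (B / m\<^sup>2) \<le> ennreal (- ln (dist z w))"
          by (intro ennreal_leI) simp
        then show ?thesis
          using False by (simp add: log_dist_def e2ennreal_ereal)
      qed (simp add: log_dist_def)
      then show "ennreal (B / m\<^sup>2) * indicator (E \<times> E) p \<le> e2ennreal (- ?L p)"
        by (auto simp: p indicator_def)
    qed
    finally show ?thesis .
  qed
  have "(\<integral>\<^sup>+ p. e2ennreal (- ?L p) \<partial>(\<nu> \<Otimes>\<^sub>M \<nu>)) = \<top>"
  proof (cases "\<integral>\<^sup>+ p. e2ennreal (- ?L p) \<partial>(\<nu> \<Otimes>\<^sub>M \<nu>)")
    case (real r)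
    then show ?thesis
      using large[of "r + 1"] by simp
  qed
  with pos show ?thesis
    unfolding log_energy_def ereal_integral_def by (simp add: zero_ennreal.rep_eq)
qed

text \<open>
  One of \<open>N\<close> sets that cover the support of a probability measure has measure at least \<open>1 / N\<close>.
  Choosing the largest share instead of summing over all sets costs a factor \<open>N\<close>, whence \<open>N\<^sup>2\<close> in
  the exponent; in exchange the sets may overlap.
\<close>

lemma polar_of_thin_covers:
  assumes diam: "\<And>x y. x \<in> K \<Longrightarrow> y \<in> K \<Longrightarrow> dist x y \<le> 1"
    and cover: "\<And>B::real. \<exists>(N::nat) E. K \<subseteq> (\<Union>j<N. E j) \<and>
      (\<forall>j<N. closed (E j) \<and> (\<forall>x\<in>E j. \<forall>y\<in>E j. dist x y \<le> exp (- B * (real N)\<^sup>2)))"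
  shows "polar K"
proof -
  have "log_energy \<nu> = -\<infinity>" if "\<nu> \<in> compact_prob_measures K" for \<nu>
  proof -
    from that obtain C where \<nu>: "prob_space \<nu>" "sets \<nu> = sets borel"
      and C: "compact C" "C \<subseteq> K" "emeasure \<nu> (- C) = 0"
      unfolding compact_prob_measures_def by blast
    interpret \<nu>: prob_space \<nu> by (rule \<nu>(1))
    have space: "space \<nu> = UNIV"
      using sets_eq_imp_space_eq[OF \<nu>(2)] by simp
    show ?thesis
    proof (rule log_energy_eq_MInfty[OF \<nu> C(1,3)])
      fix x y assume "x \<in> C" "y \<in> C"
      then show "dist x y \<le> 1"
        using diam C(2) by blast
    next
      fix B :: real assume "B \<ge> 0"
      obtain N :: nat and E where E: "K \<subseteq> (\<Union>j<N. E j)" "\<And>j. j < N \<Longrightarrow> closed (E j)"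
        "\<And>j x y. j < N \<Longrightarrow> x \<in> E j \<Longrightarrow> y \<in> E j \<Longrightarrow> dist x y \<le> exp (- B * (real N)\<^sup>2)"
        using cover[of B] by blast
      have sets: "- C \<in> sets \<nu>" "E ` {..<N} \<subseteq> sets \<nu>" "(\<Union>j<N. E j) \<in> sets \<nu>"
        using C(1) E(2) \<nu>(2) by (auto simp: compact_imp_closed borel_open open_Compl intro!: sets.finite_UN)
      have "1 = measure \<nu> (- C \<union> (\<Union>j<N. E j))"
      proof -
        have "- C \<union> (\<Union>j<N. E j) = space \<nu>"
          using C(2) E(1) space by auto
        then show ?thesis
          by (simp add: \<nu>.prob_space)
      qed
      also have "\<dots> \<le> measure \<nu> (- C) + measure \<nu> (\<Union>j<N. E j)"
        using sets by (intro measure_Un_le)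
      also have "\<dots> \<le> 0 + (\<Sum>j<N. measure \<nu> (E j))"
        using sets C(3) by (intro add_mono measure_UNION_le) (auto simp: measure_def)
      finally have sum: "1 \<le> (\<Sum>j<N. measure \<nu> (E j))"
        by simp
      then have N: "N > 0"
        by (cases N) auto
      have "\<exists>j<N. 1 / real N \<le> measure \<nu> (E j)"
      proof (rule ccontr)
        assume "\<not> ?thesis"
        then have "(\<Sum>j<N. measure \<nu> (E j)) < (\<Sum>j<N. 1 / real N)"
          using N by (intro sum_strict_mono) auto
        then show False
          using sum N by simp
      qed
      then obtain j where "j < N" "1 / real N \<le> measure \<nu> (E j)"
        by blast
      then show "\<exists>E m. closed E \<and> 0 < m \<and> m \<le> measure \<nu> E \<and>
          (\<forall>x\<in>E. \<forall>y\<in>E. dist x y \<le> exp (- B / m\<^sup>2))"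
        using E(2,3) N
        by (intro exI[of _ "E j"] exI[of _ "1 / real N"]) (auto simp: power_divide)
    qed
  qed
  then have "log_capacity K \<le> 0"
    unfolding log_capacity_def by (intro SUP_least) simp
  then show ?thesis
    unfolding polar_def by simp
qed

section \<open>The staircase function\<close>

text \<open>
  The staircase below has at level \<open>k\<close> at most \<open>2\<^sup>k\<close> jumps of this size. The power of 4 makes their
  total \<open>exp (-8\<^sup>k) / 2\<^sup>k\<^sup>+\<^sup>1\<close>, so that the jumps beyond level \<open>n\<close> add up to no more than
  \<open>exp (-8\<^sup>n)\<close>.
\<close>

definition weight :: "nat \<Rightarrow> real" where
  "weight k = exp (- (8 ^ k)) / (2 * 4 ^ k)"

text \<open>
  On \<open>[0, 1)\<close> the integer part of \<open>2\<^sup>k t\<close> counts the multiples of \<open>2\<^sup>-\<^sup>k\<close> in \<open>(0, t]\<close>. Hence this is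
  the pure jump function that jumps at the dyadic rationals. Compared with a sum of binary digits,
  this form makes every summand increasing in \<open>t\<close>.
\<close>

definition staircase :: "real \<Rightarrow> real" where
  "staircase t = (\<Sum>k. weight k * of_int \<lfloor>2 ^ k * t\<rfloor>)"

lemma weight_pos: "0 < weight k"
  by (simp add: weight_def)

lemma weight_times_power2: "weight k * 2 ^ k = exp (- (8 ^ k)) * (1 / 2) ^ Suc k"
proof -
  have "(4::real) ^ k = 2 ^ k * 2 ^ k"
    by (simp flip: power_mult_distrib)
  then show ?thesis
    by (simp add: weight_def power_divide)
qed

lemma floor_power2_bounds:
  fixes t :: real
  assumes "t \<in> {0..<1}"
  shows "0 \<le> \<lfloor>2 ^ k * t\<rfloor>" "\<lfloor>2 ^ k * t\<rfloor> < 2 ^ k"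
  using assms by (auto simp: floor_less_iff)

lemma summable_staircase:
  fixes t :: real
  assumes t: "t \<in> {0..<1}"
  shows "summable (\<lambda>k. weight k * of_int \<lfloor>2 ^ k * t\<rfloor>)"
proof (rule summable_comparison_test)
  show "summable (\<lambda>k. (1 / 2 :: real) ^ Suc k)"
    using power_half_series by (rule sums_summable)
  have "norm (weight k * of_int \<lfloor>2 ^ k * t\<rfloor>) \<le> (1 / 2) ^ Suc k" for k
  proof -
    have "real_of_int \<lfloor>2 ^ k * t\<rfloor> \<le> real_of_int (2 ^ k)"
      using floor_power2_bounds(2)[OF t, of k] by linarith
    then have "\<bar>real_of_int \<lfloor>2 ^ k * t\<rfloor>\<bar> \<le> 2 ^ k"
      using floor_power2_bounds(1)[OF t, of k] by simp
    then have "norm (weight k * of_int \<lfloor>2 ^ k * t\<rfloor>) \<le> weight k * 2 ^ k"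
      using weight_pos[of k] by (simp add: abs_mult)
    also have "\<dots> \<le> 1 * (1 / 2) ^ Suc k"
      unfolding weight_times_power2 by (intro mult_right_mono) auto
    finally show ?thesis
      by simp
  qed
  then show "\<exists>N. \<forall>k\<ge>N. norm (weight k * of_int \<lfloor>2 ^ k * t\<rfloor>) \<le> (1 / 2) ^ Suc k"
    by blast
qed

lemma staircase_diff:
  assumes "s \<in> {0..<1}" "t \<in> {0..<1}"
  shows "summable (\<lambda>k. weight k * of_int (\<lfloor>2 ^ k * s\<rfloor> - \<lfloor>2 ^ k * t\<rfloor>))"
    and "staircase s - staircase t = (\<Sum>k. weight k * of_int (\<lfloor>2 ^ k * s\<rfloor> - \<lfloor>2 ^ k * t\<rfloor>))"
  using summable_diff[OF summable_staircase[OF assms(1)] summable_staircase[OF assms(2)]]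
    suminf_diff[OF summable_staircase[OF assms(1)] summable_staircase[OF assms(2)]]
  by (simp_all add: staircase_def right_diff_distrib)

lemma floor_power2_coarsen:
  fixes s t :: real
  assumes "\<lfloor>2 ^ n * s\<rfloor> = \<lfloor>2 ^ n * t\<rfloor>" "k \<le> n"
  shows "\<lfloor>2 ^ k * s\<rfloor> = \<lfloor>2 ^ k * t\<rfloor>"
proof -
  have "\<lfloor>2 ^ k * x\<rfloor> = \<lfloor>2 ^ n * x\<rfloor> div 2 ^ (n - k)" for x :: real
  proof -
    have "(2::real) ^ n = 2 ^ k * 2 ^ (n - k)"
      using assms(2) by (simp flip: power_add)
    then have "2 ^ k * x = 2 ^ n * x / real_of_int (2 ^ (n - k))"
      by simp
    then show ?thesis
      using floor_divide_real_eq_div[of "2 ^ (n - k)" "2 ^ n * x"] by simp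
  qed
  then show ?thesis
    using assms(1) by simp
qed

text \<open>
  Two points of the same dyadic interval of level \<open>n\<close> are separated only by jumps of higher levels.
\<close>

lemma staircase_diff_le:
  assumes s: "s \<in> {0..<1}" and t: "t \<in> {0..<1}" and eq: "\<lfloor>2 ^ n * s\<rfloor> = \<lfloor>2 ^ n * t\<rfloor>"
  shows "\<bar>staircase s - staircase t\<bar> \<le> exp (- (8 ^ n))"
proof -
  have "norm (weight k * of_int (\<lfloor>2 ^ k * s\<rfloor> - \<lfloor>2 ^ k * t\<rfloor>)) \<le> exp (- (8 ^ n)) * (1 / 2) ^ Suc k" for k
  proof (cases "k \<le> n")
    case True
    then show ?thesis
      using floor_power2_coarsen[OF eq True] by simp
  next
    case False
    have "\<bar>\<lfloor>2 ^ k * s\<rfloor> - \<lfloor>2 ^ k * t\<rfloor>\<bar> \<le> 2 ^ k"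
      using floor_power2_bounds[OF s, of k] floor_power2_bounds[OF t, of k] by linarith
    then have "real_of_int \<bar>\<lfloor>2 ^ k * s\<rfloor> - \<lfloor>2 ^ k * t\<rfloor>\<bar> \<le> real_of_int (2 ^ k)"
      by (simp only: of_int_le_iff)
    then have "norm (weight k * of_int (\<lfloor>2 ^ k * s\<rfloor> - \<lfloor>2 ^ k * t\<rfloor>)) \<le> weight k * 2 ^ k"
      using weight_pos[of k] by (simp add: abs_mult)
    also have "\<dots> \<le> exp (- (8 ^ n)) * (1 / 2) ^ Suc k"
      unfolding weight_times_power2 using False
      by (intro mult_right_mono) (auto intro!: power_increasing)
    finally show ?thesis .
  qed
  moreover have sums: "(\<lambda>k. exp (- (8 ^ n)) * (1 / 2) ^ Suc k) sums (exp (- (8 ^ n)) * 1 :: real)"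
    by (intro sums_mult power_half_series)
  ultimately have "norm (\<Sum>k. weight k * of_int (\<lfloor>2 ^ k * s\<rfloor> - \<lfloor>2 ^ k * t\<rfloor>))
      \<le> (\<Sum>k. exp (- (8 ^ n)) * (1 / 2) ^ Suc k)"
    by (intro norm_suminf_le) (auto simp: sums_iff)
  then show ?thesis
    unfolding staircase_diff(2)[OF s t] using sums by (simp add: sums_iff)
qed

text \<open>
  Between points at least \<open>2\<^sup>-\<^sup>n\<close> apart there is a jump of level \<open>n\<close>. This keeps the image measure
  from concentrating, see \<open>prob_near_cantor_point\<close>.
\<close>

lemma staircase_gap:
  assumes s: "s \<in> {0..<1}" and t: "t \<in> {0..<1}" and st: "t + 1 / 2 ^ n \<le> s"
  shows "staircase t + weight n \<le> staircase s"
proof -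
  have "2 ^ n * (t + 1 / 2 ^ n) \<le> 2 ^ n * s"
    using st by (intro mult_left_mono) auto
  then have "2 ^ n * t + 1 \<le> 2 ^ n * s"
    by (simp add: distrib_left)
  then have "\<lfloor>2 ^ n * t\<rfloor> + 1 \<le> \<lfloor>2 ^ n * s\<rfloor>"
    by linarith
  then have "weight n * 1 \<le> weight n * of_int (\<lfloor>2 ^ n * s\<rfloor> - \<lfloor>2 ^ n * t\<rfloor>)"
    using weight_pos[of n] by (intro mult_left_mono) linarith+
  also have "\<dots> \<le> staircase s - staircase t"
  proof -
    have "0 \<le> weight k * of_int (\<lfloor>2 ^ k * s\<rfloor> - \<lfloor>2 ^ k * t\<rfloor>)" for k
    proof -
      have "0 < 1 / (2 ^ n :: real)"
        by simp
      then have "t \<le> s"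
        using st by linarith
      then have "\<lfloor>2 ^ k * t\<rfloor> \<le> \<lfloor>2 ^ k * s\<rfloor>"
        by (intro floor_mono) simp
      then show ?thesis
        using weight_pos[of k] by simp
    qed
    then show ?thesis
      unfolding staircase_diff(2)[OF s t]
      using sum_le_suminf[OF staircase_diff(1)[OF s t], of "{n}"] by simp
  qed
  finally show ?thesis
    by simp
qed

section \<open>The Cantor set and its pieces\<close>

definition cantor_set :: "complex set" where
  "cantor_set = closure ((\<lambda>t. of_real (staircase t)) ` {0..<1})"

definition cell :: "nat \<Rightarrow> nat \<Rightarrow> real set" where
  "cell n j = {real j / 2 ^ n ..< (real j + 1) / 2 ^ n}"

lemma mem_cell_iff: "t \<in> cell n j \<longleftrightarrow> \<lfloor>2 ^ n * t\<rfloor> = int j"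
  by (auto simp: cell_def floor_eq_iff divide_simps mult.commute)

lemma cell_subset:
  assumes "j < 2 ^ n"
  shows "cell n j \<subseteq> {0..<1}"
proof -
  have "real (j + 1) \<le> real (2 ^ n)"
    using assms by (intro of_nat_mono) simp
  then have "(real j + 1) / 2 ^ n \<le> 1"
    by simp
  moreover have "0 \<le> real j / 2 ^ n"
    by simp
  ultimately show ?thesis
    unfolding cell_def by auto
qed

lemma dist_closure_le:
  fixes S :: "'a::metric_space set"
  assumes "\<And>x y. x \<in> S \<Longrightarrow> y \<in> S \<Longrightarrow> dist x y \<le> d" "x \<in> closure S" "y \<in> closure S"
  shows "dist x y \<le> d"
proof -
  have "closure S \<subseteq> cball u d" if "u \<in> S" for u
    using assms(1)[OF that] by (intro closure_minimal) auto
  then have "S \<subseteq> cball x d"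
    using assms(2) by (simp add: dist_commute subset_iff)
  then have "closure S \<subseteq> cball x d"
    by (intro closure_minimal) auto
  then show ?thesis
    using assms(3) by auto
qed

definition piece :: "nat \<Rightarrow> nat \<Rightarrow> complex set" where
  "piece n j = closure ((\<lambda>t. of_real (staircase t)) ` cell n j)"

lemma dist_piece_le:
  assumes "j < 2 ^ n" "x \<in> piece n j" "y \<in> piece n j"
  shows "dist x y \<le> exp (- (8 ^ n))"
  using _ assms(2,3) unfolding piece_def
proof (rule dist_closure_le)
  fix x y :: complex
  assume "x \<in> (\<lambda>t. of_real (staircase t)) ` cell n j" "y \<in> (\<lambda>t. of_real (staircase t)) ` cell n j"
  then obtain s t where "s \<in> cell n j" "t \<in> cell n j" "x = of_real (staircase s)" "y = of_real (staircase t)"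
    by blast
  then show "dist x y \<le> exp (- (8 ^ n))"
    using staircase_diff_le[of s t n] cell_subset[OF assms(1)]
    by (auto simp: mem_cell_iff dist_norm subset_iff simp flip: of_real_diff)
qed

lemma cantor_set_subset_pieces: "cantor_set \<subseteq> (\<Union>j<2 ^ n. piece n j)"
  unfolding cantor_set_def
proof (rule closure_minimal)
  show "closed (\<Union>j<2 ^ n. piece n j)"
    by (intro closed_UN) (auto simp: piece_def)
  show "(\<lambda>t. of_real (staircase t)) ` {0..<1} \<subseteq> (\<Union>j<2 ^ n. piece n j)"
  proof clarify
    fix t :: real assume t: "t \<in> {0..<1}"
    let ?j = "nat \<lfloor>2 ^ n * t\<rfloor>"
    have "t \<in> cell n ?j" "?j < 2 ^ n"
      using floor_power2_bounds[OF t, of n] by (auto simp: mem_cell_iff nat_less_iff)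
    moreover from this have "of_real (staircase t) \<in> piece n ?j"
      unfolding piece_def by (intro subsetD[OF closure_subset] imageI)
    ultimately show "of_real (staircase t) \<in> (\<Union>j<2 ^ n. piece n j)"
      by blast
  qed
qed

text \<open>
  The whole set is the single piece of level 0. That its diameter is below 1 keeps the logarithmic
  kernel non-positive.
\<close>

lemma dist_cantor_set_le:
  assumes "x \<in> cantor_set" "y \<in> cantor_set"
  shows "dist x y \<le> exp (- 1)"
proof -
  have "cantor_set \<subseteq> piece 0 0"
    using cantor_set_subset_pieces[of 0] by (simp add: lessThan_Suc)
  then have "x \<in> piece 0 0" "y \<in> piece 0 0"
    using assms by blast+
  with dist_piece_le[of 0 0 x y] show ?thesis
    by simp
qed

lemma compact_cantor_set: "compact cantor_set"
proof -
  have "0 \<in> {0..<1::real}"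
    by simp
  then have "of_real (staircase 0) \<in> cantor_set"
    unfolding cantor_set_def by (intro subsetD[OF closure_subset] imageI)
  then have "cantor_set \<subseteq> cball (of_real (staircase 0)) (exp (- 1))"
    using dist_cantor_set_le by (simp add: subset_iff)
  then have "bounded cantor_set"
    using bounded_cball bounded_subset by blast
  then show ?thesis
    by (simp add: compact_eq_bounded_closed cantor_set_def)
qed

lemma polar_cantor_set: "polar cantor_set"
proof (rule polar_of_thin_covers)
  fix x y assume "x \<in> cantor_set" "y \<in> cantor_set"
  then have "dist x y \<le> exp (- 1)"
    by (rule dist_cantor_set_le)
  also have "\<dots> \<le> 1"
    by simp
  finally show "dist x y \<le> 1" .
next
  fix B :: real
  \<comment> \<open>With \<open>N = 2\<^sup>n\<close> pieces the exponent available is \<open>8\<^sup>n = 2\<^sup>n \<cdot> N\<^sup>2\<close>.\<close>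
  obtain n where n: "B < 2 ^ n"
    using real_arch_pow[of 2 B] by auto
  have "B * (2 ^ n)\<^sup>2 \<le> 2 ^ n * (2 ^ n)\<^sup>2"
    using n by (intro mult_right_mono) auto
  also have "(2::real) ^ n * (2 ^ n)\<^sup>2 = 8 ^ n"
    by (simp add: power2_eq_square flip: power_mult_distrib)
  finally have "exp (- (8 ^ n)) \<le> exp (- B * (2 ^ n)\<^sup>2)"
    by simp
  then have "dist x y \<le> exp (- B * (2 ^ n)\<^sup>2)" if "j < 2 ^ n" "x \<in> piece n j" "y \<in> piece n j" for j x y
    using dist_piece_le[OF that] by linarith
  then show "\<exists>(N::nat) E. cantor_set \<subseteq> (\<Union>j<N. E j) \<and>
      (\<forall>j<N. closed (E j) \<and> (\<forall>x\<in>E j. \<forall>y\<in>E j. dist x y \<le> exp (- B * (real N)\<^sup>2)))"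
    using cantor_set_subset_pieces[of n]
    by (intro exI[of _ "2 ^ n"] exI[of _ "piece n"]) (auto simp: piece_def)
qed

section \<open>The potential of the Cantor set\<close>

abbreviation uniform01 :: "real measure" where
  "uniform01 \<equiv> restrict_space lborel {0..<1}"

abbreviation embedded_staircase :: "real \<Rightarrow> complex" where
  "embedded_staircase t \<equiv> of_real (staircase t)"

interpretation cantor: compactly_valued uniform01 embedded_staircase cantor_set
proof -
  interpret prob_space uniform01
    by (rule prob_space_restrict_space) auto
  have "staircase \<in> borel_measurable borel"
    unfolding staircase_def by measurable
  then have "embedded_staircase \<in> borel_measurable uniform01"
    by (intro measurable_restrict_space1) measurable
  moreover have "embedded_staircase t \<in> cantor_set" if "t \<in> space uniform01" for t
    using that unfolding cantor_set_def
    by (intro subsetD[OF closure_subset] imageI) (simp add: space_restrict_space)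
  ultimately show "compactly_valued uniform01 embedded_staircase cantor_set"
    using compact_cantor_set by unfold_locales
qed

lemma prob_cell:
  assumes "j < 2 ^ n"
  shows "cell n j \<in> sets uniform01" "measure uniform01 (cell n j) = 1 / 2 ^ n"
proof -
  show "cell n j \<in> sets uniform01"
    using cell_subset[OF assms] by (simp add: sets_restrict_space_iff cell_def)
  have "measure uniform01 (cell n j) = measure lborel (cell n j)"
    using cell_subset[OF assms] by (intro measure_restrict_space) auto
  also have "\<dots> = 1 / 2 ^ n"
    by (simp add: cell_def divide_right_mono flip: diff_divide_distrib)
  finally show "measure uniform01 (cell n j) = 1 / 2 ^ n" .
qed

text \<open>
  By \<open>staircase_gap\<close> the parameters of the points in a small disc all lie within \<open>2\<^sup>-\<^sup>n\<close> of each other.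
\<close>

lemma prob_near_cantor_point:
  assumes "\<epsilon> > 0"
  shows "\<exists>r>0. \<forall>x\<in>cantor_set.
    measure uniform01 {t \<in> space uniform01. dist (embedded_staircase t) x < r} \<le> \<epsilon>"
proof -
  obtain n where n: "(1 / 2) ^ n < \<epsilon> / 2"
    using real_arch_pow_inv[of "\<epsilon> / 2" "1 / 2"] assms by auto
  have "measure uniform01 {t \<in> space uniform01. dist (embedded_staircase t) x < weight n / 2} \<le> \<epsilon>" for x
  proof -
    define A where "A = {t \<in> space uniform01. dist (embedded_staircase t) x < weight n / 2}"
    have A_sets: "A \<in> sets uniform01"
      unfolding A_def by measurable
    then have A: "A \<subseteq> {0..<1}" "A \<in> sets lborel"
      by (simp_all add: sets_restrict_space_iff)
    have "measure uniform01 A \<le> \<epsilon>"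
    proof (cases "A = {}")
      case False
      then obtain s where s: "s \<in> A"
        by blast
      have "A \<subseteq> {s - 1 / 2 ^ n..s + 1 / 2 ^ n}"
      proof
        fix t assume t: "t \<in> A"
        have "dist (embedded_staircase s) x < weight n / 2" "dist (embedded_staircase t) x < weight n / 2"
          using s t by (simp_all add: A_def)
        then have "dist (embedded_staircase s) (embedded_staircase t) < weight n"
          by (rule dist_triangle_half_l)
        then have "\<bar>staircase s - staircase t\<bar> < weight n"
          by (simp add: dist_norm flip: of_real_diff)
        moreover have "s \<in> {0..<1}" "t \<in> {0..<1}"
          using s t A(1) by blast+
        ultimately have "\<not> t + 1 / 2 ^ n \<le> s" "\<not> s + 1 / 2 ^ n \<le> t"
          using staircase_gap[of s t n] staircase_gap[of t s n] by linarith+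
        then show "t \<in> {s - 1 / 2 ^ n..s + 1 / 2 ^ n}"
          by simp
      qed
      then have "measure lborel A \<le> measure lborel {s - 1 / 2 ^ n..s + 1 / 2 ^ n}"
        using A(2) by (intro measure_mono_fmeasurable fmeasurableI) (simp_all add: emeasure_lborel_Icc_eq)
      moreover have "measure uniform01 A = measure lborel A"
        using A(1) by (intro measure_restrict_space) simp_all
      moreover have "measure lborel {s - 1 / 2 ^ n..s + 1 / 2 ^ n} = 2 * (1 / 2) ^ n"
        by (simp add: power_divide)
      ultimately show ?thesis
        using n by linarith
    qed (use assms in simp)
    then show ?thesis
      by (simp only: A_def)
  qed
  then show ?thesis
    using weight_pos[of n] by (intro exI[of _ "weight n / 2"] conjI ballI) simp_all
qed

text \<open>
  The piece that contains the nearest point of the Cantor set is used on its own. Its bound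
  \<open>2\<^sup>-\<^sup>n ln (2 exp (-8\<^sup>n))\<close> is \<open>-4\<^sup>n\<close> up to an error below 1, which comes from the factor 2.
\<close>

lemma potential_near_cantor_set:
  assumes z: "z \<notin> cantor_set" "infdist z cantor_set < exp (- (8 ^ n))"
  shows "cantor.potential z \<le> 1 - 4 ^ n"
proof -
  obtain x where x: "x \<in> cantor_set" "infdist z cantor_set = dist z x"
    using infdist_attains_inf[OF compact_imp_closed[OF compact_cantor_set] cantor.K_nonempty] by metis
  obtain j where j: "j < 2 ^ n" "x \<in> piece n j"
    using x(1) cantor_set_subset_pieces[of n] by blast
  have tri: "norm (z - embedded_staircase t) \<le> dist z x + dist x (embedded_staircase t)" for t
    using dist_triangle[of z "embedded_staircase t" x] by (simp add: dist_norm)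
  have exp1: "exp (- 1) \<le> (1 / 2 :: real)"
    using exp_ge_add_one_self[of "1::real"] by (simp add: exp_minus divide_simps)
  have exp_n: "exp (- (8 ^ n)) \<le> exp (- 1 :: real)"
    by simp
  have "cantor.potential z \<le> measure uniform01 (cell n j) * ln (2 * exp (- (8 ^ n)))"
  proof (rule cantor.potential_le)
    show "z \<notin> cantor_set" "cell n j \<in> sets uniform01"
      using z(1) prob_cell(1)[OF j(1)] by auto
    show "2 * exp (- (8 ^ n)) \<le> (1::real)"
      using exp1 exp_n by linarith
  next
    fix t assume "t \<in> cell n j"
    then have "embedded_staircase t \<in> piece n j"
      unfolding piece_def by (intro subsetD[OF closure_subset] imageI)
    then show "norm (z - embedded_staircase t) \<le> 2 * exp (- (8 ^ n))"
      using tri[of t] dist_piece_le[OF j, of "embedded_staircase t"] z(2) x(2) by linarith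
  next
    fix t assume "t \<in> space uniform01"
    then show "norm (z - embedded_staircase t) \<le> 1"
      using tri[of t] dist_cantor_set_le[OF x(1) cantor.X_in_K, of t] z(2) x(2) exp1 exp_n by linarith
  qed
  also have "\<dots> = (ln 2 - 8 ^ n) / 2 ^ n"
    by (simp add: prob_cell(2)[OF j(1)] ln_mult)
  also have "\<dots> = ln 2 / 2 ^ n - 4 ^ n"
    by (simp add: diff_divide_distrib flip: power_divide)
  also have "\<dots> \<le> 1 - 4 ^ n"
  proof -
    have "ln 2 \<le> (1::real)" "(1::real) \<le> 2 ^ n"
      using ln_add_one_self_le_self[of "1::real"] by auto
    then have "ln 2 \<le> (2::real) ^ n"
      by linarith
    then have "ln 2 / 2 ^ n \<le> (1::real)"
      by (simp add: divide_le_eq)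
    then show ?thesis
      by simp
  qed
  finally show ?thesis .
qed

lemma potential_tends_to_MInfty:
  "\<exists>\<delta>>0. \<forall>z\<in>- cantor_set. infdist z cantor_set < \<delta> \<longrightarrow> cantor.potential z < c"
proof -
  obtain n where n: "1 - c < 4 ^ n"
    using real_arch_pow[of 4 "1 - c"] by auto
  then have "cantor.potential z < c" if "z \<in> - cantor_set" "infdist z cantor_set < exp (- (8 ^ n))" for z
    using potential_near_cantor_set[of z n] that by simp
  then show ?thesis
    by (intro exI[of _ "exp (- (8 ^ n))"]) auto
qed

theorem theorem4p1:
  shows "\<exists>(K :: complex set) (u :: complex \<Rightarrow> ereal).
    K \<noteq> {} \<and> compact K \<and> polar K \<and>
    subharmonic_on u UNIV \<and>
    (\<exists>h. harmonic_on h (- K) \<and> (\<forall>z \<in> - K. u z = ereal (h z))) \<and>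
    (\<forall>z \<in> K. u z = -\<infinity>) \<and>
    ((\<lambda>z. u z / ereal (ln (infdist z K))) \<longlongrightarrow> 0)
      ((\<lambda>z. infdist z K) going_to nhds 0 within - K)"
proof -
  let ?F = "(\<lambda>z. infdist z cantor_set) going_to nhds 0 within - cantor_set"
  define u where "u = (\<lambda>z. if z \<in> cantor_set then -\<infinity> else ereal (cantor.potential z))"
  have gradient: "(cantor.potential has_derivative (\<lambda>v. Re (cantor.cauchy_transform z * v))) (at z)"
    if "z \<in> - cantor_set" for z
    using that by (intro cantor.has_derivative_potential) simp
  have subharmonic: "subharmonic_on u UNIV"
    unfolding u_def
    by (rule subharmonic_on_extend_by_MInfty[OF compact_cantor_set cantor.holomorphic_cauchy_transform
          gradient potential_tends_to_MInfty])
  have harmonic: "harmonic_on cantor.potential (- cantor_set)"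
    by (rule harmonic_on_of_holomorphic_gradient[OF _ cantor.holomorphic_cauchy_transform gradient])
      (simp add: compact_cantor_set compact_imp_closed open_Compl)
  obtain \<delta> where \<delta>: "\<delta> > 0"
    "\<And>z. z \<in> - cantor_set \<Longrightarrow> infdist z cantor_set < \<delta> \<Longrightarrow> cantor.potential z < 0"
    using potential_tends_to_MInfty[of 0] by blast
  have close: "\<forall>\<^sub>F z in ?F. z \<in> - cantor_set \<and> infdist z cantor_set < min \<delta> 1"
    unfolding eventually_going_to_nhds using \<delta>(1) by (intro exI[of _ "{..<min \<delta> 1}"]) auto
  then have "\<forall>\<^sub>F z in ?F. cantor.potential z \<le> 0"
    by eventually_elim (use \<delta>(2) in \<open>force intro: less_imp_le\<close>)
  then have "((\<lambda>z. cantor.potential z / ln (infdist z cantor_set)) \<longlongrightarrow> 0) ?F"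
    by (intro cantor.potential_sublogarithmic prob_near_cantor_point)
  then have "((\<lambda>z. ereal (cantor.potential z / ln (infdist z cantor_set))) \<longlongrightarrow> ereal 0) ?F"
    by (rule tendsto_ereal)
  moreover have "\<forall>\<^sub>F z in ?F. ereal (cantor.potential z / ln (infdist z cantor_set))
      = u z / ereal (ln (infdist z cantor_set))"
    using close
  proof eventually_elim
    case (elim z)
    then have "0 < infdist z cantor_set" "infdist z cantor_set < 1"
      using cantor.infdist_pos[of z] by auto
    then have "ln (infdist z cantor_set) \<noteq> 0"
      by simp
    then show ?case
      using elim by (simp add: u_def)
  qed
  ultimately have "((\<lambda>z. u z / ereal (ln (infdist z cantor_set))) \<longlongrightarrow> ereal 0) ?F"
    by (rule Lim_transform_eventually)
  then have "((\<lambda>z. u z / ereal (ln (infdist z cantor_set))) \<longlongrightarrow> 0) ?F"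
    by (simp only: zero_ereal_def)
  then show ?thesis
    using cantor.K_nonempty compact_cantor_set polar_cantor_set subharmonic harmonic
    by (intro exI[of _ cantor_set] exI[of _ u] conjI exI[of _ cantor.potential]) (auto simp: u_def)
qed

end
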